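(* Let $N\ge 1$, let $\rho_1,\dots,\rho_N\in\mathbb{R}$, and let $M$ be the $N\times N$ normal-form matrix with parameters $\rho_1,\dots,\rho_N$, that is, $$M = \begin{pmatrix} \rho_1 & 1 & 0 & \cdots & 0 \\ - \rho_2 & 0 & 1 & \cdots & 0 \\ \vdots & \vdots & \vdots & \ddots & \vdots \\ (-1)^{N-2} \rho_{N-1} & 0 & 0 & \cdots & 1 \\ (-1)^{N-1} \rho_N & 0 & 0 & \cdots & 0 \end{pmatrix}.$$ Let $\Gamma_{i,j}$ ($1\le i\le N$, $j\ge 2-N$) be the associated sequences, defined by $\Gamma_{i,2-j}=[M]_{i,j}$ for $1\le i,j\le N$ and $$\Gamma_{i,j}=\sum_{k=1}^N(-1)^{k-1}\rho_k\,\Gamma_{i,j-k}\qquad\text{for } 1\le i\le N,\ j\ge 2.$$ Then for every integer $n\ge 1$ and all $1\le i,j\le N$, $$\left[M^n\right]_{i,j}=\Gamma_{i,\,n-(j-1)}.$$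
   Context: $[A]_{i,j}$ denotes the entry of the matrix $A$ in row $i$ and column $j$. The entries of $M$ are: $[M]_{i,1}=(-1)^{i-1}\rho_i$ for $1\le i\le N$, $[M]_{i,i+1}=1$ for $1\le i\le N-1$, and all other entries are $0$. For each row index $i$, $\Gamma_i$ is a sequence whose terms $\Gamma_{i,j}$ are indexed by integers $j\ge 2-N$; its first $N$ terms $\Gamma_{i,2-N},\dots,\Gamma_{i,1}$ are the entries of row $i$ of $M$ read from right to left. *)

theory Defs
  imports Jordan_Normal_Form.Matrix
begin

text \<open>Matrices of the library are indexed from \<open>0\<close>; row and column indices here start at \<open>1\<close>.\<close>

definition entry :: "'a mat \<Rightarrow> nat \<Rightarrow> nat \<Rightarrow> 'a" where
  "entry A i j = A $$ (i - 1, j - 1)"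

text \<open>The parameters are \<open>\<rho> 1, \<dots>, \<rho> N\<close>; other values of \<open>\<rho>\<close> are not used.\<close>

definition normal_form_mat :: "nat \<Rightarrow> (nat \<Rightarrow> real) \<Rightarrow> real mat" where
  "normal_form_mat N \<rho> = mat N N (\<lambda>(r, c).
     let i = r + 1; j = c + 1 in
       if j = 1 then (- 1) ^ (i - 1) * \<rho> i else if j = i + 1 then 1 else 0)"

text \<open>
  For \<open>j < 2 - N\<close>, where the sequence is not defined, the value is \<open>0\<close>; the recurrence
  never reaches these indices.
\<close>

function assoc_seq :: "nat \<Rightarrow> (nat \<Rightarrow> real) \<Rightarrow> nat \<Rightarrow> int \<Rightarrow> real" where
  "assoc_seq N \<rho> i j =
     (if j < 2 - int N then 0
      else if j \<le> 1 then entry (normal_form_mat N \<rho>) i (nat (2 - j))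
      else (\<Sum>k = 1..N. (- 1) ^ (k - 1) * \<rho> k * assoc_seq N \<rho> i (j - int k)))"
  by pat_completeness auto
termination
  by (relation "measure (\<lambda>(N, \<rho>, i, j). nat (j + int N))") auto

declare assoc_seq.simps [simp del]

lemma normal_form_mat_carrier: "normal_form_mat N \<rho> \<in> carrier_mat N N"
  by (simp add: normal_form_mat_def)

lemma entry_normal_form_mat:
  assumes "1 \<le> i" "i \<le> N" "1 \<le> j" "j \<le> N"
  shows "entry (normal_form_mat N \<rho>) i j =
    (if j = 1 then (- 1) ^ (i - 1) * \<rho> i else if j = i + 1 then 1 else 0)"
  using assms by (simp add: entry_def normal_form_mat_def Let_def)

lemma assoc_seq_init:
  assumes "1 \<le> j" "j \<le> N"
  shows "assoc_seq N \<rho> i (2 - int j) = entry (normal_form_mat N \<rho>) i j"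
  using assms by (subst assoc_seq.simps) simp

lemma assoc_seq_rec:
  assumes "N \<ge> 1" "j \<ge> 2"
  shows "assoc_seq N \<rho> i j =
    (\<Sum>k = 1..N. (- 1) ^ (k - 1) * \<rho> k * assoc_seq N \<rho> i (j - int k))"
  using assms by (subst assoc_seq.simps) simp

end

theory Submission
  imports Defs
begin

text \<open>
  Right multiplication by \<open>M\<close> moves every column one place to the right and puts into
  the first column the combination of the columns with coefficients \<open>(- 1) ^ (k - 1) * \<rho> k\<close>,
  which is the recurrence of the sequences. The claim follows by induction on \<open>n\<close>.
\<close>

lemma entry_mult:
  assumes "A \<in> carrier_mat m l" "B \<in> carrier_mat l p"
    and "1 \<le> i" "i \<le> m" "1 \<le> j" "j \<le> p"
  shows "entry (A * B) i j = (\<Sum>k = 1..l. entry A i k * entry B k j)"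
proof -
  have "entry (A * B) i j = (\<Sum>k = 0..<l. A $$ (i - 1, k) * B $$ (k, j - 1))"
    using assms by (auto simp: entry_def scalar_prod_def intro!: sum.cong)
  also have "\<dots> = (\<Sum>k = 1..l. entry A i k * entry B k j)"
    \<comment> \<open>The shift by one converts the library's summation index, starting at 0, to the
      index starting at 1.\<close>
    by (rule sum.reindex_bij_witness[of _ "\<lambda>k. k - 1" Suc]) (auto simp: entry_def)
  finally show ?thesis .
qed

text \<open>Column 1 of \<open>normal_form_mat N \<rho>\<close> carries the signed parameters, while
  column j \<ge> 2 has a single nonzero entry, a 1 in row j - 1.\<close>

lemma entry_mult_normal_form_mat:
  assumes "A \<in> carrier_mat m N" and "1 \<le> i" "i \<le> m" "1 \<le> j" "j \<le> N"
  shows "entry (A * normal_form_mat N \<rho>) i j =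
    (if j = 1 then \<Sum>k = 1..N. (- 1) ^ (k - 1) * \<rho> k * entry A i k else entry A i (j - 1))"
proof -
  have eq: "entry (A * normal_form_mat N \<rho>) i j =
      (\<Sum>k = 1..N. entry A i k * entry (normal_form_mat N \<rho>) k j)"
    using assms normal_form_mat_carrier by (intro entry_mult)
  show ?thesis
  proof (cases "j = 1")
    case True
    then show ?thesis
      unfolding eq using assms by (auto simp: entry_normal_form_mat intro!: sum.cong)
  next
    case False
    have "(\<Sum>k = 1..N. entry A i k * entry (normal_form_mat N \<rho>) k j) =
        (\<Sum>k = 1..N. if k = j - 1 then entry A i k else 0)"
      using False assms by (intro sum.cong) (auto simp: entry_normal_form_mat)
    also have "\<dots> = entry A i (j - 1)"
      using False assms by (subst sum.delta) auto
    finally show ?thesis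
      unfolding eq using False by simp
  qed
qed

theorem theoremA1:
  fixes N n i j :: nat and \<rho> :: "nat \<Rightarrow> real"
  assumes "N \<ge> 1"
    and "n \<ge> 1"
    and "1 \<le> i" "i \<le> N"
    and "1 \<le> j" "j \<le> N"
  shows "entry (normal_form_mat N \<rho> ^\<^sub>m n) i j = assoc_seq N \<rho> i (int n - (int j - 1))"
  using \<open>n \<ge> 1\<close> \<open>1 \<le> j\<close> \<open>j \<le> N\<close>
\<comment> \<open>The row i stays fixed, but j must vary: an entry of the next power draws on other
  columns of the same row.\<close>
proof (induction n arbitrary: j rule: nat_induct_at_least)
  case base
  \<comment> \<open>For n = 1 the index 1 - (j - 1) is 2 - j, that of an initial term.\<close>
  have "normal_form_mat N \<rho> ^\<^sub>m 1 = normal_form_mat N \<rho>"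
    using normal_form_mat_carrier[of N \<rho>] by simp
  then show ?case
    using base assoc_seq_init[of j N \<rho> i] by (simp add: algebra_simps)
next
  case (Suc n)
  have step: "entry (normal_form_mat N \<rho> ^\<^sub>m Suc n) i j =
      (if j = 1 then \<Sum>k = 1..N. (- 1) ^ (k - 1) * \<rho> k * entry (normal_form_mat N \<rho> ^\<^sub>m n) i k
       else entry (normal_form_mat N \<rho> ^\<^sub>m n) i (j - 1))"
    using entry_mult_normal_form_mat[OF pow_carrier_mat[OF normal_form_mat_carrier]] assms Suc.prems
    by simp
  show ?case
  proof (cases "j = 1")
    case True
    \<comment> \<open>In column k the hypothesis gives the index n - (k - 1) = (n + 1) - k, as in
      the recurrence at n + 1; that recurrence is available since n + 1 \<ge> 2.\<close>
    have "(\<Sum>k = 1..N. (- 1) ^ (k - 1) * \<rho> k * entry (normal_form_mat N \<rho> ^\<^sub>m n) i k) =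
        (\<Sum>k = 1..N. (- 1) ^ (k - 1) * \<rho> k * assoc_seq N \<rho> i (int (Suc n) - int k))"
      using Suc.IH by (intro sum.cong) (auto simp: algebra_simps)
    also have "\<dots> = assoc_seq N \<rho> i (int (Suc n))"
      using assms Suc.hyps by (intro assoc_seq_rec[symmetric]) auto
    finally show ?thesis
      unfolding step using True by simp
  next
    case False
    \<comment> \<open>The index depends only on n - j, which is unchanged when n and j both drop by
      one.\<close>
    then show ?thesis
      unfolding step using Suc.IH[of "j - 1"] Suc.prems by (simp add: of_nat_diff algebra_simps)
  qed
qed

end
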